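(* Let $n,d\ge1$ be integers and $\mathbf{K}\subset\mathbb{R}^n$. The minimum (infimum) volume of a sublevel set $\{\mathbf{x}:g(\mathbf{x})\le 1\}$, $g\in\mathbf{P}[\mathbf{x}]_{2d}$, that contains $\mathbf{K}$ is $\rho/\Gamma(1+n/(2d))$, where $\rho$ is the optimal value of the finite-dimensional convex optimization problem $$\mathcal{P}:\qquad\rho=\inf_{g\in\mathbf{P}[\mathbf{x}]_{2d}}\left\{\int_{\mathbb{R}^n}\exp(-g)\,d\mathbf{x}\;:\;1-g\in C_{2d}(\mathbf{K})\right\}$$ (that is, the feasible set is a convex subset of the finite-dimensional space of homogeneous polynomials of degree $2d$, and the objective function is convex on it).
   Context: $\mathbf{P}[\mathbf{x}]_{2d}$ is the convex cone of homogeneous polynomials $g\in\mathbb{R}[x_1,\dots,x_n]$ of degree $2d$ with compact sublevel set $\{\mathbf{x}:g(\mathbf{x})\le 1\}$. $C_{2d}(\mathbf{K})$ is the convex cone of real polynomials in $n$ variables of degree at most $2d$ that are nonnegative on $\mathbf{K}$. Volume is Lebesgue measure; $\Gamma$ is the Gamma function; the infimum over the empty set is $+\infty$. *)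

theory Defs
  imports "HOL-Analysis.Analysis" "HOL-Analysis.Finite_Function_Topology"
begin

text \<open>
  Real polynomials in the variables indexed by \<open>'n\<close> are finitely supported maps from exponents
  to coefficients. The ring structure is the one of \<open>HOL-Library.Poly_Mapping\<close> (so \<open>1\<close>
  is the constant polynomial one), the real vector space structure the one of
  \<open>HOL-Analysis.Finite_Function_Topology\<close>.
\<close>

type_synonym 'n rpoly = "('n \<Rightarrow>\<^sub>0 nat) \<Rightarrow>\<^sub>0 real"

definition mdeg :: "('n::finite \<Rightarrow>\<^sub>0 nat) \<Rightarrow> nat" where
  "mdeg m = (\<Sum>i\<in>UNIV. Poly_Mapping.lookup m i)"

definition peval :: "'n::finite rpoly \<Rightarrow> real ^ 'n \<Rightarrow> real" where
  "peval p x = (\<Sum>m\<in>Poly_Mapping.keys p.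
     Poly_Mapping.lookup p m * (\<Prod>i\<in>UNIV. (x $ i) ^ Poly_Mapping.lookup m i))"

text \<open>The zero polynomial is homogeneous of every degree.\<close>

definition homogeneous_polys :: "nat \<Rightarrow> 'n::finite rpoly set" where
  "homogeneous_polys k = {p. \<forall>m\<in>Poly_Mapping.keys p. mdeg m = k}"

definition polys_le :: "nat \<Rightarrow> 'n::finite rpoly set" where
  "polys_le k = {p. \<forall>m\<in>Poly_Mapping.keys p. mdeg m \<le> k}"

definition sublevel :: "'n::finite rpoly \<Rightarrow> (real ^ 'n) set" where
  "sublevel g = {x. peval g x \<le> 1}"

text \<open>The parameter \<open>k\<close> of \<open>P_cone\<close> and \<open>C_cone\<close> is the degree itself, i.e. \<open>2 * d\<close> in the application.\<close>

definition P_cone :: "nat \<Rightarrow> 'n::finite rpoly set" where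
  "P_cone k = {g \<in> homogeneous_polys k. compact (sublevel g)}"

definition C_cone :: "nat \<Rightarrow> (real ^ 'n) set \<Rightarrow> 'n::finite rpoly set" where
  "C_cone k K = {p \<in> polys_le k. \<forall>x\<in>K. 0 \<le> peval p x}"

definition feasible :: "nat \<Rightarrow> (real ^ 'n) set \<Rightarrow> 'n::finite rpoly set" where
  "feasible k K = {g \<in> P_cone k. 1 - g \<in> C_cone k K}"

text \<open>
  Extended nonnegative values are used so that a divergent integral would be \<open>\<infinity>\<close>
  (rather than the default value \<open>0\<close> of the Bochner integral) and so that the infimum over
  the empty set is \<open>\<infinity>\<close>.
\<close>

definition objective :: "'n::finite rpoly \<Rightarrow> ennreal" where
  "objective g = (\<integral>\<^sup>+ x. ennreal (exp (- peval g x)) \<partial>lborel)"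

definition opt_value :: "nat \<Rightarrow> (real ^ 'n::finite) set \<Rightarrow> ennreal" where
  "opt_value k K = (INF g\<in>feasible k K. objective g)"

end

theory Submission
  imports Defs
begin

text \<open>
  A homogeneous \<open>g\<close> of degree \<open>k > 0\<close> with bounded sublevel set is nonnegative, since the ray
  through a point where \<open>g\<close> is negative stays in the sublevel set. For such \<open>g\<close> the layer cake
  formula together with \<open>vol {g \<le> t} = t powr (n / k) * vol {g \<le> 1}\<close> gives
  \<open>\<integral> exp (- g) = vol {g \<le> 1} * \<integral>\<^sub>0\<^sup>\<infinity> t powr (n / k) * exp (- t) = vol {g \<le> 1} * Gamma (1 + n / k)\<close>,
  so both minimisation problems have proportional objectives. Convexity of the objective is that
  of \<open>\<lambda>y. exp (- y)\<close>, integrated pointwise.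
\<close>

section \<open>Integrals of homogeneous functions\<close>

text \<open>Supplies the layer cake representation: with \<open>a = f x\<close> it turns
  \<open>exp (- f x)\<close> into an integral over the levels \<open>t\<close> above
  \<open>f x\<close>.\<close>

lemma nn_integral_exp_atLeast:
  fixes a :: real
  shows "(\<integral>\<^sup>+ t. ennreal (exp (- t)) * indicator {a..} t \<partial>lborel) = ennreal (exp (- a))"
proof -
  have "((\<lambda>t::real. - exp (- t)) \<longlongrightarrow> - 0) at_top"
    by (intro tendsto_minus filterlim_compose[OF exp_at_bot] filterlim_uminus_at_bot_at_top)
  then have "(\<integral>\<^sup>+ t. ennreal (exp (- t)) * indicator {a..} t \<partial>lborel)
      = ennreal (- 0 - (- exp (- a)))"
    by (intro nn_integral_FTC_atLeast) (auto intro!: derivative_eq_intros)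
  then show ?thesis by simp
qed

text \<open>The dilation by \<open>t powr (1 / k)\<close> carries the sublevel set at 1 onto the one
  at \<open>t\<close> and multiplies volume by the \<open>DIM('a)\<close>-th power of its
  factor.\<close>

lemma emeasure_lborel_scaled_sublevel:
  fixes f :: "'a::euclidean_space \<Rightarrow> real"
  assumes [measurable]: "f \<in> borel_measurable borel"
    and hom: "\<And>s x. s > 0 \<Longrightarrow> f (s *\<^sub>R x) = s ^ k * f x"
    and k: "k > 0" and t: "t > 0"
  shows "emeasure lborel {x. f x \<le> t}
    = ennreal (t powr (real DIM('a) / real k)) * emeasure lborel {x. f x \<le> 1}"
proof -
  define s where "s = t powr (1 / real k)"
  have s: "s > 0" "s ^ k = t" "s ^ DIM('a) = t powr (real DIM('a) / real k)"
    using t k by (simp_all add: s_def powr_powr flip: powr_realpow)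
  \<comment> \<open>The zero translation gives the image the form used by the affine change of
    variables.\<close>
  have eq: "{x. f x \<le> t} = (\<lambda>x. s *\<^sub>R x + 0) ` {x. f x \<le> 1}"
  proof (intro set_eqI iffI)
    fix x assume x: "x \<in> {x. f x \<le> t}"
    have "f x = t * f (inverse s *\<^sub>R x)"
      using hom[of s "inverse s *\<^sub>R x"] s by simp
    then have "f (inverse s *\<^sub>R x) \<le> 1"
      using x t by simp
    then show "x \<in> (\<lambda>x. s *\<^sub>R x + 0) ` {x. f x \<le> 1}"
      using s by (intro image_eqI[of _ _ "inverse s *\<^sub>R x"]) auto
  next
    fix x assume "x \<in> (\<lambda>x. s *\<^sub>R x + 0) ` {x. f x \<le> 1}"
    then show "x \<in> {x. f x \<le> t}"
      using hom s t by auto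
  qed
  \<comment> \<open>The affine rule concerns the completed measure, which agrees with
    \<open>lborel\<close> on these Borel sets.\<close>
  have "emeasure lborel {x. f x \<le> c} = emeasure lebesgue {x. f x \<le> c}" for c
    by simp
  then show ?thesis
    using emeasure_lebesgue_affine[of s 0 "{x. f x \<le> 1}", folded eq] s by (simp add: ennreal_power)
qed

lemma nn_integral_exp_homogeneous:
  fixes f :: "'a::euclidean_space \<Rightarrow> real"
  assumes [measurable]: "f \<in> borel_measurable borel"
    and hom: "\<And>s x. s > 0 \<Longrightarrow> f (s *\<^sub>R x) = s ^ k * f x"
    and k: "k > 0" and nonneg: "\<And>x. f x \<ge> 0"
  shows "(\<integral>\<^sup>+ x. ennreal (exp (- f x)) \<partial>lborel)
    = ennreal (Gamma (1 + real DIM('a) / real k)) * emeasure lborel {x. f x \<le> 1}"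
proof -
  let ?a = "real DIM('a) / real k"
  have "(\<integral>\<^sup>+ x. ennreal (exp (- f x)) \<partial>lborel)
      = (\<integral>\<^sup>+ x. (\<integral>\<^sup>+ t. ennreal (exp (- t)) * (if f x \<le> t then 1 else 0) \<partial>lborel) \<partial>lborel)"
    by (subst nn_integral_exp_atLeast[symmetric])
      (auto intro!: nn_integral_cong simp: indicator_def)
  \<comment> \<open>Tonelli applies because the condition \<open>f x \<le> t\<close> is jointly
    measurable in \<open>x\<close> and \<open>t\<close>.\<close>
  also have "\<dots> = (\<integral>\<^sup>+ t. (\<integral>\<^sup>+ x. ennreal (exp (- t)) * (if f x \<le> t then 1 else 0) \<partial>lborel) \<partial>lborel)"
    by (rule lborel_pair.Fubini'[symmetric]) measurable
  also have "\<dots> = (\<integral>\<^sup>+ t. ennreal (exp (- t)) * emeasure lborel {x. f x \<le> t} \<partial>lborel)"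
  proof (intro nn_integral_cong)
    fix t :: real
    have "(\<integral>\<^sup>+ x. ennreal (exp (- t)) * (if f x \<le> t then 1 else 0) \<partial>lborel)
        = (\<integral>\<^sup>+ x. ennreal (exp (- t)) * indicator {x. f x \<le> t} x \<partial>lborel)"
      by (auto intro!: nn_integral_cong simp: indicator_def)
    also have "\<dots> = ennreal (exp (- t)) * emeasure lborel {x. f x \<le> t}"
      by (rule nn_integral_cmult_indicator) measurable
    finally show "(\<integral>\<^sup>+ x. ennreal (exp (- t)) * (if f x \<le> t then 1 else 0) \<partial>lborel)
        = ennreal (exp (- t)) * emeasure lborel {x. f x \<le> t}" .
  qed
  \<comment> \<open>The integrand takes the shape of Euler's integral for
    \<open>Gamma (1 + ?a)\<close>. For \<open>t < 0\<close> both sides vanish. The null point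
    \<open>t = 0\<close> is left out: there the right side is 0, while
    \<open>{x. f x \<le> 0}\<close> may have positive volume.\<close>
  also have "\<dots> = (\<integral>\<^sup>+ t. ennreal (indicator {0..} t * t powr ((1 + ?a) - 1) / exp t)
                        * emeasure lborel {x. f x \<le> 1} \<partial>lborel)"
  proof (intro nn_integral_cong_AE)
    have "ennreal (exp (- t)) * emeasure lborel {x. f x \<le> t}
        = ennreal (indicator {0..} t * t powr ((1 + ?a) - 1) / exp t)
          * emeasure lborel {x. f x \<le> 1}" if "t \<noteq> 0" for t :: real
    proof (cases "t > 0")
      case True
      have "indicator {0..} t * t powr ((1 + ?a) - 1) / exp t = exp (- t) * t powr ?a"
        using True by (simp add: exp_minus divide_inverse mult.commute)
      then show ?thesis
        using emeasure_lborel_scaled_sublevel[OF assms(1) hom k True]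
        by (simp only: ennreal_mult'' powr_ge_zero mult.assoc)
    next
      case False
      then have "t < 0"
        using that by simp
      moreover from this have "{x. f x \<le> t} = {}"
        using nonneg by (force simp: not_le intro: less_le_trans)
      ultimately show ?thesis
        by simp
    qed
    then show "AE t in lborel. ennreal (exp (- t)) * emeasure lborel {x. f x \<le> t}
        = ennreal (indicator {0..} t * t powr ((1 + ?a) - 1) / exp t)
          * emeasure lborel {x. f x \<le> 1}"
      using AE_lborel_singleton[of "0::real"] by auto
  qed
  also have "\<dots> = ennreal (Gamma (1 + ?a)) * emeasure lborel {x. f x \<le> 1}"
  proof -
    have "1 + ?a > 0"
      using k by (simp add: add_pos_nonneg)
    then show ?thesis
      by (subst nn_integral_multc) (simp_all only: Gamma_conv_nn_integral_real, measurable)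
  qed
  finally show ?thesis .
qed

section \<open>Polynomials\<close>

lemma lookup_scaleR [simp]:
  "Poly_Mapping.lookup (r *\<^sub>R p) m = r *\<^sub>R Poly_Mapping.lookup p m"
  by (simp add: scaleR_poly_mapping_def)

text \<open>Polynomials with different supports can then be evaluated over one common finite index
  set, as the proof of additivity requires.\<close>

lemma peval_superset:
  assumes "finite A" "Poly_Mapping.keys p \<subseteq> A"
  shows "peval p x = (\<Sum>m\<in>A. Poly_Mapping.lookup p m * (\<Prod>i\<in>UNIV. (x $ i) ^ Poly_Mapping.lookup m i))"
  unfolding peval_def using assms by (intro sum.mono_neutral_left) (auto simp: in_keys_iff)

lemma peval_add: "peval (p + q) x = peval p x + peval q x"
proof -
  let ?A = "Poly_Mapping.keys p \<union> Poly_Mapping.keys q"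
  have "finite ?A" "Poly_Mapping.keys (p + q) \<subseteq> ?A"
    by (simp_all add: Poly_Mapping.keys_add)
  then show ?thesis
    by (simp add: peval_superset[of ?A] lookup_add distrib_right sum.distrib)
qed

lemma peval_scaleR: "peval (r *\<^sub>R p) x = r * peval p x"
proof -
  have "Poly_Mapping.keys (r *\<^sub>R p) \<subseteq> Poly_Mapping.keys p"
    by (auto simp: in_keys_iff)
  then show ?thesis
    by (simp add: peval_superset[of "Poly_Mapping.keys p"] sum_distrib_left mult.assoc)
qed

lemma peval_one [simp]: "peval 1 x = 1"
  by (simp add: peval_def)

lemma peval_diff: "peval (p - q) x = peval p x - peval q x"
  using peval_add[of "p - q" q x] by simp

lemma peval_homogeneous:
  assumes "g \<in> homogeneous_polys k"
  shows "peval g (s *\<^sub>R x) = s ^ k * peval g x"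
proof -
  have "(\<Prod>i\<in>UNIV. ((s *\<^sub>R x) $ i) ^ Poly_Mapping.lookup m i)
      = s ^ k * (\<Prod>i\<in>UNIV. (x $ i) ^ Poly_Mapping.lookup m i)" if "m \<in> Poly_Mapping.keys g" for m
  proof -
    have "k = mdeg m"
      using assms that by (auto simp: homogeneous_polys_def)
    then show ?thesis
      by (simp add: mdeg_def power_mult_distrib prod.distrib power_sum)
  qed
  then show ?thesis
    by (simp add: peval_def sum_distrib_left mult.left_commute)
qed

lemma continuous_on_peval [continuous_intros]: "continuous_on S (peval p)"
  unfolding peval_def by (intro continuous_intros)

lemma borel_measurable_peval [measurable]: "peval p \<in> borel_measurable borel"
  by (intro borel_measurable_continuous_onI continuous_intros)

lemma closed_sublevel: "closed (sublevel g)"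
  unfolding sublevel_def by (intro closed_Collect_le continuous_intros)

section \<open>Nonnegativity, integral and volume on the cone\<close>

lemma peval_nonneg:
  assumes g: "g \<in> P_cone k" and k: "k > 0"
  shows "peval g x \<ge> 0"
proof (rule ccontr)
  assume neg: "\<not> ?thesis"
  have hom: "peval g (s *\<^sub>R y) = s ^ k * peval g y" for s y
    using g by (intro peval_homogeneous) (simp add: P_cone_def)
  \<comment> \<open>Homogeneity with \<open>s = 0\<close> gives the value 0 at the origin, because
    \<open>k > 0\<close>.\<close>
  have "x \<noteq> 0"
    using hom[of 0 0] neg k by (auto simp: zero_power)
  have "bounded (sublevel g)"
    using g by (simp add: P_cone_def compact_imp_bounded)
  then obtain b where b: "\<And>y. y \<in> sublevel g \<Longrightarrow> norm y \<le> b"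
    unfolding bounded_iff by blast
  \<comment> \<open>This factor puts \<open>s *\<^sub>R x\<close> at norm
    \<open>\<bar>b\<bar> + 1\<close>, beyond the bound \<open>b\<close>.\<close>
  define s where "s = (\<bar>b\<bar> + 1) / norm x"
  have s: "s \<ge> 0" "s * norm x = \<bar>b\<bar> + 1"
    using \<open>x \<noteq> 0\<close> by (simp_all add: s_def)
  have "s ^ k * peval g x \<le> 0"
    using neg s by (intro mult_nonneg_nonpos) auto
  then have "s *\<^sub>R x \<in> sublevel g"
    by (simp add: sublevel_def hom)
  then show False
    using b[of "s *\<^sub>R x"] s by simp
qed

lemma objective_eq_volume:
  fixes g :: "'n::finite rpoly"
  assumes g: "g \<in> P_cone k" and k: "k > 0"
  shows "objective g = ennreal (Gamma (1 + real CARD('n) / real k)) * emeasure lborel (sublevel g)"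
  unfolding objective_def sublevel_def
  using nn_integral_exp_homogeneous[of "peval g" k] g k peval_nonneg[OF g k]
  by (simp add: peval_homogeneous P_cone_def)

lemma objective_finite:
  assumes g: "g \<in> P_cone k" and k: "k > 0"
  shows "objective g < \<infinity>"
proof -
  have "emeasure lborel (sublevel g) < \<infinity>"
    using g by (intro emeasure_bounded_finite compact_imp_bounded) (simp add: P_cone_def)
  then show ?thesis
    unfolding objective_eq_volume[OF assms] by (simp add: ennreal_mult_less_top)
qed

section \<open>Finite dimension of the space of forms\<close>

lemma subspace_homogeneous_polys: "subspace (homogeneous_polys k)"
  unfolding subspace_def homogeneous_polys_def
  by (auto simp: in_keys_iff lookup_add)

text \<open>Each exponent is at most the total degree, so the exponent vectors lie in a finite
  box.\<close>

lemma finite_mdeg_eq: "finite {m :: 'n::finite \<Rightarrow>\<^sub>0 nat. mdeg m = k}"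
proof -
  have "Poly_Mapping.lookup ` {m :: 'n \<Rightarrow>\<^sub>0 nat. mdeg m = k} \<subseteq> PiE UNIV (\<lambda>_. {..k})"
    by (auto simp: mdeg_def intro!: member_le_sum)
  then have "finite (Poly_Mapping.lookup ` {m :: 'n \<Rightarrow>\<^sub>0 nat. mdeg m = k})"
    by (rule finite_subset) (simp add: finite_PiE)
  then show ?thesis
    by (rule finite_imageD) (simp add: inj_on_def poly_mapping_eqI)
qed

lemma span_monomials:
  "span ((\<lambda>m. Poly_Mapping.single m (1::real)) ` {m. mdeg m = k}) = homogeneous_polys k"
    (is "span ?B = _")
proof
  have "?B \<subseteq> homogeneous_polys k"
    by (auto simp: homogeneous_polys_def)
  then show "span ?B \<subseteq> homogeneous_polys k"
    by (rule span_minimal) (rule subspace_homogeneous_polys)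
next
  show "homogeneous_polys k \<subseteq> span ?B"
  proof
    fix p :: "'a rpoly" assume p: "p \<in> homogeneous_polys k"
    have "p = (\<Sum>m\<in>Poly_Mapping.keys p. Poly_Mapping.lookup p m *\<^sub>R Poly_Mapping.single m 1)"
      by (rule poly_mapping_eqI)
        (auto simp: lookup_sum lookup_single when_def in_keys_iff sum.delta' if_distrib cong: if_cong)
    also have "\<dots> \<in> span ?B"
      using p by (intro span_sum span_scale span_base) (auto simp: homogeneous_polys_def)
    finally show "p \<in> span ?B" .
  qed
qed

section \<open>The optimization problem\<close>

text \<open>The degree bound in \<open>C_cone\<close> is automatic: \<open>1 - g\<close> has only
  exponents of degree 0 and \<open>k\<close>. What remains of the constraint is
  \<open>peval g x \<le> 1\<close> on \<open>K\<close>.\<close>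

lemma feasible_eq:
  fixes K :: "(real ^ 'n::finite) set"
  shows "feasible k K = {g \<in> P_cone k. K \<subseteq> sublevel g}"
proof -
  have "1 - g \<in> polys_le k" if "g \<in> homogeneous_polys k" for g :: "'n rpoly"
    using that keys_diff[of 1 g] by (force simp: polys_le_def homogeneous_polys_def mdeg_def)
  then show ?thesis
    by (auto simp: feasible_def P_cone_def C_cone_def sublevel_def peval_diff)
qed

text \<open>The point is compactness. Where \<open>g\<close> and \<open>h\<close> both exceed 1, so
  does their convex combination; its closed sublevel set therefore lies in the union of two compact
  ones.\<close>

lemma convex_feasible:
  fixes K :: "(real ^ 'n::finite) set"
  shows "convex (feasible k K)"
proof (rule convexI)
  fix g h :: "'n rpoly" and u v :: real
  assume gh: "g \<in> feasible k K" "h \<in> feasible k K" and uv: "0 \<le> u" "0 \<le> v" "u + v = 1"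
  let ?f = "u *\<^sub>R g + v *\<^sub>R h"
  have f: "peval ?f x = u * peval g x + v * peval h x" for x
    by (simp add: peval_add peval_scaleR)
  have "sublevel ?f \<subseteq> sublevel g \<union> sublevel h"
  proof (rule ccontr)
    assume "\<not> ?thesis"
    then obtain x where "peval ?f x \<le> 1" "\<not> peval g x \<le> 1" "\<not> peval h x \<le> 1"
      unfolding sublevel_def by blast
    \<comment> \<open>The signs are flipped because \<open>convex_bound_lt\<close> gives strict
      upper bounds.\<close>
    moreover from this have "u * (- peval g x) + v * (- peval h x) < - 1"
      using uv by (intro convex_bound_lt) auto
    ultimately show False by (simp add: f)
  qed
  moreover have "compact (sublevel g \<union> sublevel h)"
    using gh by (auto simp: feasible_eq P_cone_def)
  ultimately have "compact (sublevel ?f)"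
    using closed_sublevel by (metis compact_eq_bounded_closed bounded_subset)
  moreover have "?f \<in> homogeneous_polys k"
    using gh by (intro subspace_add subspace_scale subspace_homogeneous_polys)
      (auto simp: feasible_eq P_cone_def)
  moreover have "K \<subseteq> sublevel ?f"
    using gh uv by (auto simp: feasible_eq sublevel_def f intro!: convex_bound_le)
  ultimately show "?f \<in> feasible k K"
    by (simp add: feasible_eq P_cone_def)
qed

text \<open>Kept in \<open>ennreal\<close>, so that divergent integrals of arbitrary
  \<open>g\<close> and \<open>h\<close> are covered too.\<close>

lemma objective_convex_combination:
  assumes uv: "0 \<le> u" "0 \<le> v" "u + v = 1"
  shows "objective (u *\<^sub>R g + v *\<^sub>R h) \<le> ennreal u * objective g + ennreal v * objective h"
proof -
  have "exp (- peval (u *\<^sub>R g + v *\<^sub>R h) x) \<le> u * exp (- peval g x) + v * exp (- peval h x)" for x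
  proof -
    have "exp (u *\<^sub>R (- peval g x) + v *\<^sub>R (- peval h x)) \<le> u * exp (- peval g x) + v * exp (- peval h x)"
      using exp_convex uv unfolding convex_on_def by blast
    then show ?thesis
      by (simp add: peval_add peval_scaleR)
  qed
  then have "objective (u *\<^sub>R g + v *\<^sub>R h)
      \<le> (\<integral>\<^sup>+ x. ennreal u * ennreal (exp (- peval g x)) + ennreal v * ennreal (exp (- peval h x)) \<partial>lborel)"
    unfolding objective_def using uv
    by (intro nn_integral_mono) (simp flip: ennreal_mult ennreal_plus)
  also have "\<dots> = ennreal u * objective g + ennreal v * objective h"
    unfolding objective_def by (simp add: nn_integral_add nn_integral_cmult)
  finally show ?thesis .
qed

lemma convex_on_objective:
  fixes K :: "(real ^ 'n::finite) set"
  assumes k: "k > 0"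
  shows "convex_on (feasible k K) (\<lambda>g. enn2real (objective g))"
  unfolding convex_on_def
proof (intro conjI convex_feasible ballI allI impI)
  fix g h :: "'n rpoly" and u v :: real
  assume gh: "g \<in> feasible k K" "h \<in> feasible k K" and uv: "0 \<le> u" "0 \<le> v" "u + v = 1"
  \<comment> \<open>Since \<open>enn2real\<close> sends \<infinity> to 0, finiteness is what lets
    the inequality pass to the reals.\<close>
  have fin: "objective g < \<infinity>" "objective h < \<infinity>"
    using gh by (simp_all only: feasible_eq mem_Collect_eq objective_finite[OF _ k])
  then have "enn2real (objective (u *\<^sub>R g + v *\<^sub>R h))
      \<le> enn2real (ennreal u * objective g + ennreal v * objective h)"
    using objective_convex_combination[OF uv]
    by (intro enn2real_mono) (auto simp: ennreal_mult_less_top)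
  also have "\<dots> = u * enn2real (objective g) + v * enn2real (objective h)"
    using fin uv by (subst enn2real_plus) (auto simp: ennreal_mult_less_top enn2real_mult)
  finally show "enn2real (objective (u *\<^sub>R g + v *\<^sub>R h))
      \<le> u * enn2real (objective g) + v * enn2real (objective h)" .
qed

text \<open>Division by a positive finite constant is inverted by multiplication, so it is an order
  isomorphism of the extended half-line. An empty \<open>I\<close> gives \<infinity> on both
  sides.\<close>

lemma INF_divide_ennreal:
  fixes f :: "'a \<Rightarrow> ennreal"
  assumes c: "0 < c"
  shows "(INF i\<in>I. f i) / ennreal c = (INF i\<in>I. f i / ennreal c)"
proof (rule antisym)
  show "(INF i\<in>I. f i) / ennreal c \<le> (INF i\<in>I. f i / ennreal c)"
    by (intro INF_greatest divide_right_mono_ennreal INF_lower)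
  have "(INF i\<in>I. f i / ennreal c) * ennreal c \<le> f i" if "i \<in> I" for i
  proof -
    have "(INF i\<in>I. f i / ennreal c) * ennreal c \<le> f i / ennreal c * ennreal c"
      using that by (intro mult_right_mono INF_lower) auto
    also have "\<dots> = f i"
      using c by (simp add: ennreal_divide_times ennreal_divide_self mult_divide_eq_ennreal)
    finally show ?thesis .
  qed
  then have "(INF i\<in>I. f i / ennreal c) * ennreal c / ennreal c \<le> (INF i\<in>I. f i) / ennreal c"
    by (intro divide_right_mono_ennreal INF_greatest)
  then show "(INF i\<in>I. f i / ennreal c) \<le> (INF i\<in>I. f i) / ennreal c"
    using c by (simp add: mult_divide_eq_ennreal)
qed

theorem proposition3p1:
  fixes K :: "(real ^ 'n::finite) set" and d :: nat
  assumes "d \<ge> 1"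
  shows "((INF g\<in>{g \<in> P_cone (2 * d). K \<subseteq> sublevel g}. emeasure lborel (sublevel g))
           = opt_value (2 * d) K / ennreal (Gamma (1 + real CARD('n) / (2 * real d))))
     \<and> (subspace (homogeneous_polys (2 * d) :: 'n rpoly set))
     \<and> (\<exists>B :: 'n rpoly set. finite B \<and> span B = homogeneous_polys (2 * d))
     \<and> (feasible (2 * d) K \<subseteq> homogeneous_polys (2 * d))
     \<and> (convex (feasible (2 * d) K))
     \<and> (\<forall>g\<in>feasible (2 * d) K. objective g < \<infinity>)
     \<and> (convex_on (feasible (2 * d) K) (\<lambda>g. enn2real (objective g)))"
proof (intro conjI)
  let ?c = "Gamma (1 + real CARD('n) / (2 * real d))"
  have k: "2 * d > 0"
    using assms by simp
  have c: "?c > 0"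
    by (intro Gamma_real_pos add_pos_nonneg) simp_all
  have "objective g / ennreal ?c = emeasure lborel (sublevel g)" if "g \<in> P_cone (2 * d)"
    for g :: "'n rpoly"
    using objective_eq_volume[OF that k] c by (simp add: mult.commute mult_divide_eq_ennreal)
  then show "(INF g\<in>{g \<in> P_cone (2 * d). K \<subseteq> sublevel g}. emeasure lborel (sublevel g))
      = opt_value (2 * d) K / ennreal ?c"
    unfolding opt_value_def INF_divide_ennreal[OF c] feasible_eq by (intro INF_cong) auto
  \<comment> \<open>The witness is the finite set of monomials of degree \<open>2 * d\<close> with
    coefficient 1.\<close>
  show "\<exists>B :: 'n rpoly set. finite B \<and> span B = homogeneous_polys (2 * d)"
    using finite_imageI[OF finite_mdeg_eq] span_monomials by (intro exI conjI)
  show "feasible (2 * d) K \<subseteq> homogeneous_polys (2 * d)"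
    by (auto simp: feasible_def P_cone_def)
  show "\<forall>g\<in>feasible (2 * d) K. objective g < \<infinity>"
    using objective_finite[OF _ k] by (simp only: feasible_def mem_Collect_eq Ball_def) blast
qed (use assms in \<open>simp_all add: subspace_homogeneous_polys convex_feasible convex_on_objective\<close>)

end
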